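(* For each property $P$ among prefix-convex, suffix-convex, factor-convex, subword-convex, prefix-closed, suffix-closed, factor-closed, subword-closed, there exists a family of NFAs $(M_n)$, where $M_n$ has $O(n)$ states and $L(M_n)$ does not have property $P$, such that the shortest witness to the failure of $P$ for $L(M_n)$ has length $2^{\Omega(n)}$.
   Context: Relations on words: $v$ is a prefix of $w$ if $w = vx$; a suffix if $w = xv$; a factor if $w = xvy$; a subword if $v$ is obtained from $w$ by deleting some not necessarily contiguous letters. For such a relation $\unlhd$: $L$ is $\unlhd$-convex if $u,w \in L$ and $u \unlhd v \unlhd w$ imply $v \in L$, and a witness to its failure is a triple $(u,v,w)$ with $u,w\in L$, $v \notin L$, $u \unlhd v \unlhd w$; $L$ is $\unlhd$-closed if $w \in L$ and $v \unlhd w$ imply $v \in L$, and a witness to its failure is a pair $(v,w)$ with $w \in L$, $v\notin L$, $v \unlhd w$. The length (size) of a witness is $|w|$. *)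

theory Defs
  imports Complex_Main "HOL-Library.Sublist" "HOL-Library.Landau_Symbols"
begin

record ('s, 'a) nfa =
  states :: "'s set"
  alphabet :: "'a set"
  delta :: "'s \<Rightarrow> 'a \<Rightarrow> 's set"
  init :: 's
  final :: "'s set"

definition is_nfa :: "('s, 'a) nfa \<Rightarrow> bool" where
  "is_nfa M \<longleftrightarrow>
     finite (states M) \<and> finite (alphabet M) \<and>
     init M \<in> states M \<and> final M \<subseteq> states M \<and>
     (\<forall>q \<in> states M. \<forall>a \<in> alphabet M. delta M q a \<subseteq> states M)"

fun delta_star :: "('s, 'a) nfa \<Rightarrow> 's set \<Rightarrow> 'a list \<Rightarrow> 's set" where
  "delta_star M S [] = S"
| "delta_star M S (a # w) = delta_star M (\<Union>q\<in>S. delta M q a) w"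

definition lang :: "('s, 'a) nfa \<Rightarrow> 'a list set" where
  "lang M = {w \<in> lists (alphabet M). delta_star M {init M} w \<inter> final M \<noteq> {}}"

definition convex_lang :: "('a list \<Rightarrow> 'a list \<Rightarrow> bool) \<Rightarrow> 'a list set \<Rightarrow> bool" where
  "convex_lang R L \<longleftrightarrow> (\<forall>u v w. u \<in> L \<longrightarrow> w \<in> L \<longrightarrow> R u v \<longrightarrow> R v w \<longrightarrow> v \<in> L)"

definition closed_lang :: "('a list \<Rightarrow> 'a list \<Rightarrow> bool) \<Rightarrow> 'a list set \<Rightarrow> bool" where
  "closed_lang R L \<longleftrightarrow> (\<forall>v w. w \<in> L \<longrightarrow> R v w \<longrightarrow> v \<in> L)"

definition convex_witness ::
  "('a list \<Rightarrow> 'a list \<Rightarrow> bool) \<Rightarrow> 'a list set \<Rightarrow> 'a list \<Rightarrow> 'a list \<Rightarrow> 'a list \<Rightarrow> bool" where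
  "convex_witness R L u v w \<longleftrightarrow> u \<in> L \<and> w \<in> L \<and> v \<notin> L \<and> R u v \<and> R v w"

definition closed_witness ::
  "('a list \<Rightarrow> 'a list \<Rightarrow> bool) \<Rightarrow> 'a list set \<Rightarrow> 'a list \<Rightarrow> 'a list \<Rightarrow> bool" where
  "closed_witness R L v w \<longleftrightarrow> w \<in> L \<and> v \<notin> L \<and> R v w"

text \<open>The next two are meaningful only if a witness exists, i.e. if the property fails.\<close>

definition shortest_convex_witness :: "('a list \<Rightarrow> 'a list \<Rightarrow> bool) \<Rightarrow> 'a list set \<Rightarrow> nat" where
  "shortest_convex_witness R L = (LEAST k. \<exists>u v w. convex_witness R L u v w \<and> length w = k)"

definition shortest_closed_witness :: "('a list \<Rightarrow> 'a list \<Rightarrow> bool) \<Rightarrow> 'a list set \<Rightarrow> nat" where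
  "shortest_closed_witness R L = (LEAST k. \<exists>v w. closed_witness R L v w \<and> length w = k)"

text \<open>This is \<open>f(n) = 2^\<Omega>(n)\<close>. The Landau symbol only sees
  absolute values, so \<open>g \<ge> 0\<close> has to be required separately.\<close>

definition exp_Omega :: "(nat \<Rightarrow> nat) \<Rightarrow> bool" where
  "exp_Omega f \<longleftrightarrow>
     (\<exists>g :: nat \<Rightarrow> real. (\<forall>n. 0 \<le> g n) \<and> g \<in> \<Omega>(\<lambda>n. real n) \<and> (\<forall>n. real (f n) = 2 powr g n))"

lemma not_convex_lang_iff: "\<not> convex_lang R L \<longleftrightarrow> (\<exists>u v w. convex_witness R L u v w)"
  unfolding convex_lang_def convex_witness_def by blast

lemma not_closed_lang_iff: "\<not> closed_lang R L \<longleftrightarrow> (\<exists>v w. closed_witness R L v w)"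
  unfolding closed_lang_def closed_witness_def by blast

end

theory Submission imports Defs begin

text \<open>
  One family of automata serves all eight properties. Let \<open>L\<close> contain the empty word and reject some
  words, all of them of length at least \<open>2^n\<close>. If \<open>v \<unlhd> w\<close> for some rejected \<open>v\<close>
  and some \<open>w \<in> L\<close>, then \<open>([], v, w)\<close> and \<open>(v, w)\<close> are witnesses, and every witness is at least as long
  as its rejected word.

  The rejected words are prefixes of the history of an \<open>n\<close>-bit counter, written in rows of
  \<open>n + 1\<close> letters (least significant bit first, then an end marker), where each letter also holds the
  carry into its position. A letter is determined by the letter just before it and the letter
  \<open>n + 1\<close> places before it, so an automaton with \<open>O(n)\<close> states can guess and verify an error.
  A word without errors is rejected only if it ends with an overflowing row, and the first overflow
  happens in row \<open>2^n - 1\<close>.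
\<close>

section \<open>The history of a binary counter\<close>

definition counter_kind :: "nat \<Rightarrow> nat \<Rightarrow> nat" where
  "counter_kind n i =
     (if i mod Suc n = n then 2 else (i div Suc n) div 2 ^ (i mod Suc n) mod 2)"

text \<open>Incrementing \<open>r\<close> carries into bit \<open>j\<close> iff all lower bits of
  \<open>r\<close> are 1, that is, iff \<open>2 ^ j\<close> divides \<open>r + 1\<close>. At the end
  marker this means overflow.\<close>

definition counter_carry :: "nat \<Rightarrow> nat \<Rightarrow> bool" where
  "counter_carry n i \<longleftrightarrow> 2 ^ (i mod Suc n) dvd Suc (i div Suc n)"

text \<open>A letter is \<open>2 * kind + carry\<close>, the kind being a bit or \<open>2\<close> for the end marker. In particular
  a letter produces a carry for its right neighbour iff it is at least \<open>3\<close>.\<close>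

definition counter_letter :: "nat \<Rightarrow> nat \<Rightarrow> nat" where
  "counter_letter n i = 2 * counter_kind n i + of_bool (counter_carry n i)"

text \<open>On bits this is the sum modulo 2 of bit and carry: letter \<open>1\<close> is bit 0 with
  carry, letter \<open>2\<close> is bit 1 without. Markers, including the virtual \<open>6\<close>,
  stay markers.\<close>

definition next_kind :: "nat \<Rightarrow> nat" where
  "next_kind a = (if 4 \<le> a then 2 else if a = 1 \<or> a = 2 then 1 else 0)"

text \<open>The letter \<open>6\<close> is virtual: it precedes every word and acts as the marker of a row before the
  first one.\<close>

definition counter_stream :: "nat \<Rightarrow> nat \<Rightarrow> nat" where
  "counter_stream n i = (case i of 0 \<Rightarrow> 6 | Suc j \<Rightarrow> counter_letter n j)"

lemma counter_kind_le: "counter_kind n i \<le> 2"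
  by (simp add: counter_kind_def)

lemma counter_letter_less: "counter_letter n i < 6"
  using counter_kind_le[of n i] by (simp add: counter_letter_def)

lemma counter_letter_div_2: "counter_letter n i div 2 = counter_kind n i"
  by (simp add: counter_letter_def)

lemma odd_counter_letter: "odd (counter_letter n i) \<longleftrightarrow> counter_carry n i"
  by (simp add: counter_letter_def)

lemma power_Suc_dvd_Suc_iff:
  "2 ^ Suc j dvd Suc r \<longleftrightarrow> odd (r div 2 ^ j) \<and> 2 ^ j dvd Suc r"
proof (cases "2 ^ j dvd Suc r")
  case True
  then obtain m where m: "Suc r = 2 ^ j * m" by (elim dvdE)
  have "Suc r div 2 ^ j = Suc (r div 2 ^ j)"
    using True by (simp add: div_Suc mod_eq_0_iff_dvd)
  then have "Suc (r div 2 ^ j) = m" using m by simp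
  moreover have "2 ^ Suc j dvd Suc r \<longleftrightarrow> even m" by (simp add: m mult.commute)
  ultimately show ?thesis using True by auto
next
  case False
  then show ?thesis by (meson dvd_trans le_imp_power_dvd le_add2 plus_1_eq_Suc lessI less_imp_le)
qed

lemma letter_ge_3_iff:
  "3 \<le> counter_letter n i \<longleftrightarrow>
     counter_kind n i = 2 \<or> counter_kind n i = 1 \<and> counter_carry n i"
  using counter_kind_le[of n i] by (auto simp: counter_letter_def of_bool_def)

text \<open>A marker always passes on a carry: it supplies the 1 that is added to each row.\<close>

lemma counter_carry_Suc: "counter_carry n (Suc i) \<longleftrightarrow> 3 \<le> counter_letter n i"
proof (cases "i mod Suc n = n")
  case True
  then have "Suc i mod Suc n = 0" by (simp add: mod_Suc)
  then show ?thesis using True by (simp add: letter_ge_3_iff counter_kind_def counter_carry_def)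
next
  case False
  then have "Suc i mod Suc n = Suc (i mod Suc n)" "Suc i div Suc n = i div Suc n"
    by (simp_all add: mod_Suc div_Suc)
  moreover have "x mod 2 \<noteq> 2" for x :: nat by (metis less_irrefl mod_less_divisor pos2)
  ultimately show ?thesis using False
    by (simp add: letter_ge_3_iff counter_kind_def counter_carry_def power_Suc_dvd_Suc_iff
        odd_iff_mod_2_eq_one del: power_Suc)
qed

lemma counter_carry_stream: "counter_carry n m \<longleftrightarrow> 3 \<le> counter_stream n m"
proof (cases m)
  case 0
  then show ?thesis by (simp add: counter_stream_def counter_carry_def)
qed (simp add: counter_stream_def counter_carry_Suc)

lemma counter_kind_add_row: "counter_kind n (i + Suc n) = next_kind (counter_letter n i)"
proof (cases "i mod Suc n = n")
  case True
  then have "counter_kind n i = 2" by (simp add: counter_kind_def)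
  moreover have "counter_kind n (i + Suc n) = 2"
    using True unfolding counter_kind_def by (metis mod_add_self2)
  ultimately show ?thesis by (simp add: counter_letter_def next_kind_def)
next
  case False
  have m: "(i + Suc n) mod Suc n = i mod Suc n" and d: "(i + Suc n) div Suc n = Suc (i div Suc n)"
    by (metis mod_add_self2) (metis Suc_eq_plus1 div_add_self2 nat.distinct(1))
  have "Suc (i div Suc n) div 2 ^ (i mod Suc n) =
      (i div Suc n) div 2 ^ (i mod Suc n) + of_bool (counter_carry n i)"
    by (simp add: div_Suc counter_carry_def mod_eq_0_iff_dvd)
  then have "counter_kind n (i + Suc n) = (counter_kind n i + of_bool (counter_carry n i)) mod 2"
    using False unfolding counter_kind_def m d by (simp add: mod_add_left_eq)
  moreover have "counter_kind n i = 0 \<or> counter_kind n i = 1"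
    using False by (auto simp: counter_kind_def)
  ultimately show ?thesis
    by (cases "counter_carry n i"; elim disjE) (simp_all add: counter_letter_def next_kind_def)
qed

text \<open>Row 0 has only zero bits, and its marker comes from the virtual \<open>6\<close>. The
  stream is shifted by one, so index \<open>m - n\<close> is the letter \<open>n + 1\<close> places
  back.\<close>

lemma counter_kind_stream:
  "counter_kind n m = (if m < n then 0 else next_kind (counter_stream n (m - n)))"
proof -
  consider "m < n" | "m = n" | i where "m = i + Suc n"
    by (metis add.commute add_Suc_right less_iff_Suc_add linorder_cases)
  then show ?thesis
  proof cases
    case 3
    then have "m - n = Suc i" by simp
    then show ?thesis using 3 counter_kind_add_row[of n i] by (simp add: counter_stream_def)
  qed (simp_all add: counter_kind_def counter_stream_def next_kind_def)
qed

text \<open>\<open>bad_pair n k a b\<close> says that \<open>a\<close> followed by \<open>b\<close> at distance \<open>k + 1\<close> is an error.\<close>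

definition bad_pair :: "nat \<Rightarrow> nat \<Rightarrow> nat \<Rightarrow> nat \<Rightarrow> bool" where
  "bad_pair n k a b \<longleftrightarrow>
     k = 0 \<and> (odd b \<longleftrightarrow> a < 3) \<or>
     k = n \<and> b div 2 \<noteq> next_kind a \<or>
     k < n \<and> a = 6 \<and> b div 2 \<noteq> 0"

text \<open>Distance \<open>1\<close> determines the carry and distance \<open>n + 1\<close> the
  kind. Within the bits of row 0 the virtual letter is still nearer than that and forces bit
  0.\<close>

lemma no_bad_pair_iff:
  "(\<forall>k\<le>n. k \<le> m \<longrightarrow> \<not> bad_pair n k (counter_stream n (m - k)) b) \<longleftrightarrow> b = counter_letter n m"
  (is "?G \<longleftrightarrow> _")
proof -
  have six: "counter_stream n i = 6 \<longleftrightarrow> i = 0" for i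
    using counter_letter_less by (auto simp: counter_stream_def nat_neq_iff split: nat.split)
  have "?G \<longleftrightarrow> (odd b \<longleftrightarrow> 3 \<le> counter_stream n m) \<and>
      (n \<le> m \<longrightarrow> b div 2 = next_kind (counter_stream n (m - n))) \<and> (m < n \<longrightarrow> b div 2 = 0)"
    (is "_ \<longleftrightarrow> ?H")
  proof
    assume G: ?G
    show ?H
      \<comment> \<open>The case \<open>k = m\<close> reaches back to the virtual letter.\<close>
      using G[rule_format, of 0] G[rule_format, of n] G[rule_format, of m]
      by (auto simp: bad_pair_def six)
  next
    assume ?H
    then show ?G by (auto simp: bad_pair_def six)
  qed
  also have "\<dots> \<longleftrightarrow> (odd b \<longleftrightarrow> counter_carry n m) \<and> b div 2 = counter_kind n m"
    by (auto simp: counter_carry_stream counter_kind_stream)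
  also have "\<dots> \<longleftrightarrow> b = counter_letter n m"
  proof
    assume *: "(odd b \<longleftrightarrow> counter_carry n m) \<and> b div 2 = counter_kind n m"
    have "b = 2 * (b div 2) + of_bool (odd b)" by (metis mod_2_eq_odd mult_div_mod_eq)
    then show "b = counter_letter n m" using * by (simp add: counter_letter_def)
  qed (simp add: counter_letter_div_2 odd_counter_letter)
  finally show ?thesis .
qed

section \<open>The automaton\<close>

text \<open>State \<open>7 * k + a\<close> with \<open>k \<le> n\<close> and \<open>a < 7\<close> remembers the letter \<open>a\<close> read \<open>k + 1\<close> steps ago;
  state \<open>7 * (n + 1)\<close> means that an error was found.\<close>

definition counter_nfa :: "nat \<Rightarrow> (nat, nat) nfa" where
  "counter_nfa n = \<lparr>
     states = {..7 * Suc n},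
     alphabet = {..<6},
     delta = (\<lambda>q b. if q = 7 * Suc n then {q} else
        {p. q div 7 < n \<and> p = q + 7 \<or>
            q div 7 = 0 \<and> p = b \<or>
            bad_pair n (q div 7) (q mod 7) b \<and> p = 7 * Suc n}),
     init = 6,
     final = insert (7 * Suc n) ({..<7} - {5})\<rparr>"

lemma counter_nfa_simps [simp]:
  "states (counter_nfa n) = {..7 * Suc n}"
  "alphabet (counter_nfa n) = {..<6}"
  "init (counter_nfa n) = 6"
  "final (counter_nfa n) = insert (7 * Suc n) ({..<7} - {5})"
  by (simp_all add: counter_nfa_def)

lemma is_nfa_counter_nfa: "is_nfa (counter_nfa n)"
proof -
  have "q + 7 \<le> 7 * Suc n" if "q div 7 < n" for q :: nat
    using that by (simp add: div_less_iff_less_mult)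
  then show ?thesis by (auto simp: is_nfa_def counter_nfa_def split: if_splits)
qed

lemma delta_star_snoc:
  "delta_star M S (w @ [a]) = (\<Union>q\<in>delta_star M S w. delta M q a)"
  by (induction w arbitrary: S) simp_all

text \<open>The list argument is the word read so far in reverse, ending in the virtual letter \<open>6\<close>, so that
  index \<open>k\<close> holds the letter read \<open>k + 1\<close> steps ago. The same holds for \<open>memory_states\<close>.\<close>

fun has_error :: "nat \<Rightarrow> nat list \<Rightarrow> bool" where
  "has_error n [] = False"
| "has_error n (b # V) \<longleftrightarrow>
     has_error n V \<or> (\<exists>k\<le>n. k < length V \<and> bad_pair n k (V ! k) b)"

text \<open>The first wrong letter is detected because all letters before it are still those of the
  counter; errors persist afterwards.\<close>

lemma has_error_iff:
  "has_error n (rev w @ [6]) \<longleftrightarrow> w \<noteq> map (counter_letter n) [0..<length w]"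
proof (induction w rule: rev_induct)
  case (snoc b w)
  show ?case
  proof (cases "w = map (counter_letter n) [0..<length w]")
    case False
    then show ?thesis using snoc by auto
  next
    case True
    define m where "m = length w"
    have nth: "(rev w @ [6]) ! k = counter_stream n (m - k)" if "k \<le> m" for k
    proof (cases "k = m")
      case False
      then have "k < m" using that by simp
      then have "rev w ! k = w ! (m - Suc k)" by (simp add: rev_nth m_def)
      also have "\<dots> = counter_letter n (m - Suc k)"
        using \<open>k < m\<close> by (subst True) (simp add: m_def)
      also have "\<dots> = counter_stream n (m - k)"
        using \<open>k < m\<close> by (simp add: counter_stream_def Suc_diff_Suc[symmetric])
      finally show ?thesis using \<open>k < m\<close> by (simp add: nth_append m_def)
    qed (simp add: nth_append m_def counter_stream_def)
    have "has_error n (rev (w @ [b]) @ [6]) \<longleftrightarrow>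
        (\<exists>k\<le>n. k \<le> m \<and> bad_pair n k ((rev w @ [6]) ! k) b)"
      using snoc True by (simp add: m_def less_Suc_eq_le)
    also have "\<dots> \<longleftrightarrow> \<not> (\<forall>k\<le>n. k \<le> m \<longrightarrow> \<not> bad_pair n k (counter_stream n (m - k)) b)"
      using nth by auto
    also have "\<dots> \<longleftrightarrow> b \<noteq> counter_letter n m"
      by (simp add: no_bad_pair_iff)
    finally show ?thesis using True by (simp add: m_def)
  qed
qed simp

definition memory_states :: "nat \<Rightarrow> nat list \<Rightarrow> nat set" where
  "memory_states n V = {7 * k + V ! k | k. k \<le> n \<and> k < length V}"

lemma delta_memory_state:
  assumes "k \<le> n" "a < 7"
  shows "delta (counter_nfa n) (7 * k + a) b =
    {p. k < n \<and> p = 7 * Suc k + a \<or> k = 0 \<and> p = b \<or> bad_pair n k a b \<and> p = 7 * Suc n}"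
proof -
  have "7 * k + a \<noteq> 7 * Suc n" "(7 * k + a) div 7 = k" "(7 * k + a) mod 7 = a"
    "7 * k + a + 7 = 7 * Suc k + a"
    using assms by auto
  then show ?thesis by (auto simp: counter_nfa_def)
qed

lemma delta_memory_states:
  assumes "V \<noteq> []" "set V \<subseteq> {..<7}"
  shows "(\<Union>q\<in>memory_states n V. delta (counter_nfa n) q b) =
    memory_states n (b # V) \<union>
    (if \<exists>k\<le>n. k < length V \<and> bad_pair n k (V ! k) b then {7 * Suc n} else {})"
proof -
  have less: "V ! k < 7" if "k < length V" for k
    using that assms(2) by (meson lessThan_iff nth_mem subsetD)
  have "(\<Union>q\<in>memory_states n V. delta (counter_nfa n) q b) =
    (\<Union>k\<in>{k. k \<le> n \<and> k < length V}. delta (counter_nfa n) (7 * k + V ! k) b)"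
    by (auto simp: memory_states_def)
  also have "\<dots> = (\<Union>k\<in>{k. k \<le> n \<and> k < length V}.
    {p. k < n \<and> p = 7 * Suc k + V ! k \<or> k = 0 \<and> p = b \<or>
        bad_pair n k (V ! k) b \<and> p = 7 * Suc n})"
    using less by (intro SUP_cong refl delta_memory_state) auto
  also have "\<dots> = insert b {7 * Suc k + V ! k | k. k < n \<and> k < length V} \<union>
    (if \<exists>k\<le>n. k < length V \<and> bad_pair n k (V ! k) b then {7 * Suc n} else {})"
    \<comment> \<open>Since \<open>V\<close> is nonempty, a state with \<open>k = 0\<close> is
      present to spawn the new letter \<open>b\<close>.\<close>
    using assms(1) by (simp del: mult_Suc_right) (blast intro: less_imp_le)
  also have "insert b {7 * Suc k + V ! k | k. k < n \<and> k < length V} = memory_states n (b # V)"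
  proof -
    have "{k. k \<le> n \<and> k < length (b # V)} = insert 0 (Suc ` {k. k < n \<and> k < length V})"
      by (auto simp: image_iff less_Suc_eq_0_disj Suc_le_eq)
    moreover have "memory_states n (b # V) =
        (\<lambda>k. 7 * k + (b # V) ! k) ` {k. k \<le> n \<and> k < length (b # V)}"
      unfolding memory_states_def by blast
    ultimately have "memory_states n (b # V) =
        (\<lambda>k. 7 * k + (b # V) ! k) ` insert 0 (Suc ` {k. k < n \<and> k < length V})"
      by simp
    then show ?thesis by (auto simp: image_image)
  qed
  finally show ?thesis .
qed

lemma delta_star_counter_nfa:
  assumes "w \<in> lists {..<6}"
  shows "delta_star (counter_nfa n) {6} w =
    memory_states n (rev w @ [6]) \<union> (if has_error n (rev w @ [6]) then {7 * Suc n} else {})"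
  using assms
proof (induction w rule: rev_induct)
  case Nil
  then show ?case by (auto simp: memory_states_def)
next
  case (snoc b w)
  have "set (rev w @ [6]) \<subseteq> {..<7}" using snoc.prems by fastforce
  note step = delta_memory_states[OF _ this, of n b]
  have acc: "delta (counter_nfa n) (7 * Suc n) b = {7 * Suc n}" by (simp add: counter_nfa_def)
  show ?case
    using snoc step acc by (auto simp: delta_star_snoc simp del: mult_Suc_right)
qed

lemma lang_counter_nfa:
  "lang (counter_nfa n) = {w \<in> lists {..<6}.
     \<not> (w \<noteq> [] \<and> last w = 5 \<and> w = map (counter_letter n) [0..<length w])}"
proof -
  have "delta_star (counter_nfa n) {6} w \<inter> final (counter_nfa n) \<noteq> {} \<longleftrightarrow>
      \<not> (w \<noteq> [] \<and> last w = 5 \<and> w = map (counter_letter n) [0..<length w])"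
    if w: "w \<in> lists {..<6}" for w
  proof -
    define V where "V = rev w @ [6]"
    have "set V \<subseteq> {..<7}" using w by (fastforce simp: V_def)
    then have V: "V ! k < 7" if "k < length V" for k
      using that by (meson lessThan_iff nth_mem subsetD)
    have "V \<noteq> []" by (simp add: V_def)
    have hd: "hd V = (if w = [] then 6 else last w)" by (simp add: V_def hd_append hd_rev)
    have "7 * Suc n \<notin> memory_states n V"
      using V by (fastforce simp: memory_states_def)
    \<comment> \<open>Only states with \<open>k = 0\<close> lie below \<open>7\<close>, so besides
      the error state acceptance depends on the latest letter alone.\<close>
    moreover have "memory_states n V \<inter> {..<7} = {hd V}"
    proof (intro equalityI subsetI)
      fix q assume "q \<in> memory_states n V \<inter> {..<7}"
      then obtain k where "q = 7 * k + V ! k" "q < 7" by (auto simp: memory_states_def)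
      moreover from this have "k = 0" by simp
      ultimately show "q \<in> {hd V}" using \<open>V \<noteq> []\<close> by (simp add: hd_conv_nth)
    next
      fix q assume "q \<in> {hd V}"
      then have "q = 7 * 0 + V ! 0" "q < 7" using V[of 0] \<open>V \<noteq> []\<close> by (simp_all add: hd_conv_nth)
      moreover have "0 < length V" using \<open>V \<noteq> []\<close> by simp
      ultimately show "q \<in> memory_states n V \<inter> {..<7}" unfolding memory_states_def by blast
    qed
    ultimately have mem: "memory_states n V \<inter> final (counter_nfa n) = {hd V} - {5}"
      by (simp only: counter_nfa_simps Int_insert_right_if0 Int_Diff[symmetric] not_False_eq_True)
    have err: "w = map (counter_letter n) [0..<length w] \<longleftrightarrow> \<not> has_error n V"
      unfolding V_def has_error_iff by (rule not_not[symmetric])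
    show ?thesis
      unfolding err delta_star_counter_nfa[OF w, folded V_def] Int_Un_distrib2 mem hd
      by simp
  qed
  then show ?thesis
    unfolding lang_def counter_nfa_simps(2,3) by (intro Collect_cong conj_cong refl)
qed

lemma rejected_length:
  assumes "w \<in> lists {..<6}" "w \<notin> lang (counter_nfa n)"
  shows "2 ^ n \<le> length w"
proof -
  from assms have w: "w \<noteq> []" "last w = 5" "w = map (counter_letter n) [0..<length w]"
    by (auto simp: lang_counter_nfa)
  define i where "i = length w - 1"
  have "w ! i = counter_letter n i" using w(1) by (subst w(3)) (simp add: i_def)
  then have five: "counter_letter n i = 5" using w(1,2) by (simp add: last_conv_nth i_def)
  have "counter_kind n i = 2" "counter_carry n i"
    using counter_letter_div_2[of n i] odd_counter_letter[of n i] by (simp_all add: five)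
  then have "2 ^ n dvd Suc (i div Suc n)"
    by (auto simp: counter_kind_def counter_carry_def split: if_splits)
  then have "2 ^ n \<le> Suc (i div Suc n)" by (rule dvd_imp_le) simp
  also have "\<dots> \<le> length w" using div_le_dividend[of i "Suc n"] w(1)
    by (cases w) (simp_all add: i_def)
  finally show ?thesis .
qed

lemma rejected_word_exists:
  obtains v where "v \<in> lists {..<6}" "v \<notin> lang (counter_nfa n)"
    "v @ [0] \<in> lang (counter_nfa n)" "0 # v \<in> lang (counter_nfa n)"
proof -
  \<comment> \<open>This is the total length of rows \<open>0\<close> to \<open>2 ^ n - 1\<close>,
    so the last letter is the first overflowing marker.\<close>
  define l where "l = 2 ^ n * Suc n"
  define v where "v = map (counter_letter n) [0..<l]"
  have "l > 0" by (simp add: l_def)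
  obtain r where r: "2 ^ n = Suc r" by (metis not0_implies_Suc power_not_zero zero_neq_numeral)
  have i: "l - 1 = n + r * Suc n" by (simp add: l_def r)
  have "(l - 1) mod Suc n = n" unfolding i by (metis lessI mod_less mod_mult_self1)
  moreover have "(l - 1) div Suc n = r" unfolding i by (simp add: div_mult_self1 del: mult_Suc_right)
  ultimately have "counter_letter n (l - 1) = 5"
    by (simp add: counter_letter_def counter_kind_def counter_carry_def r)
  then have last: "last v = 5" using \<open>l > 0\<close> by (simp add: v_def last_map)
  have v: "v \<in> lists {..<6}" using counter_letter_less by (auto simp: v_def)
  have "v \<noteq> []" "v = map (counter_letter n) [0..<length v]" using \<open>l > 0\<close> by (simp_all add: v_def)
  then have rej: "v \<notin> lang (counter_nfa n)" using last by (auto simp: lang_counter_nfa)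
  \<comment> \<open>The history starts with a carry, so a prepended \<open>0\<close> is an error at
    once.\<close>
  have "odd (counter_letter n 0)" by (simp add: odd_counter_letter counter_carry_def)
  then have "counter_letter n 0 \<noteq> 0" by (metis even_zero)
  then have "0 # v \<noteq> map (counter_letter n) [0..<length (0 # v)]"
    by (simp del: upt_Suc add: upt_conv_Cons)
  moreover have "0 # v \<in> lists {..<6}" using v by simp
  ultimately have "0 # v \<in> lang (counter_nfa n)" by (simp only: lang_counter_nfa mem_Collect_eq) simp
  moreover have "v @ [0] \<in> lang (counter_nfa n)" using v by (simp add: lang_counter_nfa)
  ultimately show ?thesis using that v rej by blast
qed

section \<open>Witnesses\<close>

lemma exp_OmegaI:
  assumes "\<And>n. 2 ^ n \<le> f n"
  shows "exp_Omega f"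
proof -
  define g where "g n = log 2 (real (f n))" for n
  have f: "2 ^ n \<le> real (f n)" for n
    using assms[of n] by (metis of_nat_le_iff of_nat_numeral of_nat_power)
  have pos: "0 < real (f n)" for n using f[of n] by (rule less_le_trans[rotated]) simp
  have g: "real n \<le> g n" for n
    using f[of n] pos[of n] by (simp add: g_def le_log_iff powr_realpow)
  then have "g \<in> \<Omega>(\<lambda>n. real n)"
    by (intro landau_omega.bigI[of 1] always_eventually) (auto intro: order_trans[OF _ abs_ge_self])
  moreover have "0 \<le> g n" for n using g[of n] by linarith
  moreover have "real (f n) = 2 powr g n" for n using pos by (simp add: g_def)
  ultimately show ?thesis unfolding exp_Omega_def by blast
qed

lemma card_states_counter_nfa: "(\<lambda>n. real (card (states (counter_nfa n)))) \<in> O(\<lambda>n. real n)"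
\<comment> \<open>There are \<open>7 * n + 8\<close> states, at most \<open>15 * n\<close> once
  \<open>n\<close> is positive.\<close>
proof (rule landau_o.bigI[of 15])
  show "\<forall>\<^sub>F n in sequentially. norm (real (card (states (counter_nfa n)))) \<le> 15 * norm (real n)"
    using eventually_ge_at_top[of 1] by eventually_elim simp
qed simp

theorem theorem17:
  fixes R :: "nat list \<Rightarrow> nat list \<Rightarrow> bool"
  assumes "R \<in> {prefix, suffix, sublist, subseq}"
  shows
    "(\<exists>(A :: nat set) (M :: nat \<Rightarrow> (nat, nat) nfa).
        (\<forall>n. is_nfa (M n) \<and> alphabet (M n) = A) \<and>
        (\<lambda>n. real (card (states (M n)))) \<in> O(\<lambda>n. real n) \<and>
        (\<forall>n. \<not> convex_lang R (lang (M n))) \<and>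
        exp_Omega (\<lambda>n. shortest_convex_witness R (lang (M n)))) \<and>
     (\<exists>(A :: nat set) (M :: nat \<Rightarrow> (nat, nat) nfa).
        (\<forall>n. is_nfa (M n) \<and> alphabet (M n) = A) \<and>
        (\<lambda>n. real (card (states (M n)))) \<in> O(\<lambda>n. real n) \<and>
        (\<forall>n. \<not> closed_lang R (lang (M n))) \<and>
        exp_Omega (\<lambda>n. shortest_closed_witness R (lang (M n))))"
proof -
  let ?L = "\<lambda>n. lang (counter_nfa n)"
  have R_subseq: "subseq v w" if "R v w" for v w
    using assms that
    by auto
  have R_Nil: "R [] v" for v using assms by auto
  \<comment> \<open>Appending serves every relation except \<open>suffix\<close>, for which a letter
    is prepended.\<close>
  have ext: "R v (v @ [0]) \<or> R v (0 # v)" for v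
    using assms by (auto simp: suffix_ConsI)
  have long: "2 ^ n \<le> length w" if "w \<in> ?L n" "v \<notin> ?L n" "R v w" for n v w
  proof -
    have "subseq v w" using R_subseq that(3) .
    then have "v \<in> lists {..<6}"
      using that(1) by (auto simp: lang_counter_nfa in_lists_conv_set elim: list_emb_set)
    then have "2 ^ n \<le> length v" using rejected_length that(2) by blast
    then show ?thesis using list_emb_length[OF \<open>subseq v w\<close>] by simp
  qed
  have wit: "\<exists>v w. convex_witness R (?L n) [] v w \<and> closed_witness R (?L n) v w" for n
  proof -
    obtain v where v: "v \<notin> ?L n" "v @ [0] \<in> ?L n" "0 # v \<in> ?L n"
      using rejected_word_exists by metis
    moreover have "[] \<in> ?L n" by (simp add: lang_counter_nfa)
    ultimately show ?thesis
      using ext[of v] R_Nil unfolding convex_witness_def closed_witness_def by blast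
  qed
  have "2 ^ n \<le> shortest_convex_witness R (?L n)" for n
    unfolding shortest_convex_witness_def
    by (rule LeastI2_ex) (use wit in blast, use long in \<open>auto simp: convex_witness_def\<close>)
  then have convex: "exp_Omega (\<lambda>n. shortest_convex_witness R (?L n))" by (rule exp_OmegaI)
  have "2 ^ n \<le> shortest_closed_witness R (?L n)" for n
    unfolding shortest_closed_witness_def
    by (rule LeastI2_ex) (use wit in blast, use long in \<open>auto simp: closed_witness_def\<close>)
  then have closed: "exp_Omega (\<lambda>n. shortest_closed_witness R (?L n))" by (rule exp_OmegaI)
  have "\<not> convex_lang R (?L n)" "\<not> closed_lang R (?L n)" for n
    using wit not_convex_lang_iff not_closed_lang_iff by blast+
  moreover have "is_nfa (counter_nfa n) \<and> alphabet (counter_nfa n) = {..<6}" for n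
    by (simp add: is_nfa_counter_nfa)
  ultimately show ?thesis
    using card_states_counter_nfa convex closed by blast
qed

end
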